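(* Every biconvex graph $G$ with bipartition $(A,B)$ has a proper conflict-free $6$-coloring $c$ such that $|c(A)|\le 3$ and $|c(B)|\le 3$.
   Context: Graphs are finite and simple. A bipartite graph with bipartition $(A,B)$ is biconvex if there is a linear order of $A$ such that for every $w\in B$ the vertices of $N(w)$ appear consecutively in it, and there is a linear order of $B$ such that for every $w\in A$ the vertices of $N(w)$ appear consecutively in it. A proper conflict-free $k$-coloring of $G$ is a proper vertex coloring with at most $k$ colors in which, for every non-isolated vertex $v$, some color appears exactly once in the open neighborhood $N(v)$. $c(Z)$ denotes the set of colors used by $c$ on a vertex set $Z$. *)

theory Defs
  imports "Graph_Theory.Pair_Digraph"
begin

text \<open>
  A finite simple graph is a \<open>pair_graph\<close>: a finite, loopfree, symmetric digraph without
  parallel arcs, in which the edge \<open>uv\<close> is the pair of opposite arcs \<open>(u, v)\<close> and \<open>(v, u)\<close>.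
\<close>

definition neighborhood :: "'a pair_pre_digraph \<Rightarrow> 'a \<Rightarrow> 'a set" where
  "neighborhood G v = {u. (v, u) \<in> parcs G}"

text \<open>The parts may be empty, and isolated vertices may lie in either part.\<close>

definition bipartition :: "'a pair_pre_digraph \<Rightarrow> 'a set \<Rightarrow> 'a set \<Rightarrow> bool" where
  "bipartition G A B \<longleftrightarrow>
     pverts G = A \<union> B \<and> A \<inter> B = {} \<and> parcs G \<subseteq> A \<times> B \<union> B \<times> A"

definition consecutive_in :: "'a rel \<Rightarrow> 'a set \<Rightarrow> bool" where
  "consecutive_in r S \<longleftrightarrow> (\<forall>x\<in>S. \<forall>z\<in>S. \<forall>y. (x, y) \<in> r \<and> (y, z) \<in> r \<longrightarrow> y \<in> S)"

definition biconvex :: "'a pair_pre_digraph \<Rightarrow> 'a set \<Rightarrow> 'a set \<Rightarrow> bool" where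
  "biconvex G A B \<longleftrightarrow>
     bipartition G A B \<and>
     (\<exists>r. linear_order_on A r \<and> (\<forall>w\<in>B. consecutive_in r (neighborhood G w))) \<and>
     (\<exists>r. linear_order_on B r \<and> (\<forall>w\<in>A. consecutive_in r (neighborhood G w)))"

definition proper_coloring :: "'a pair_pre_digraph \<Rightarrow> nat \<Rightarrow> ('a \<Rightarrow> 'c) \<Rightarrow> bool" where
  "proper_coloring G k c \<longleftrightarrow>
     card (c ` pverts G) \<le> k \<and> (\<forall>(u, v) \<in> parcs G. c u \<noteq> c v)"

definition proper_conflict_free_coloring ::
    "'a pair_pre_digraph \<Rightarrow> nat \<Rightarrow> ('a \<Rightarrow> 'c) \<Rightarrow> bool" where
  "proper_conflict_free_coloring G k c \<longleftrightarrow>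
     proper_coloring G k c \<and>
     (\<forall>v\<in>pverts G. neighborhood G v \<noteq> {} \<longrightarrow>
        (\<exists>a. \<exists>!u. u \<in> neighborhood G v \<and> c u = a))"

end

theory Submission
  imports Defs
begin

text \<open>
  The order of \<open>B\<close> forces that no neighborhood \<open>N(w)\<close>, \<open>w \<in> B\<close>, meets three pairwise disjoint
  neighborhoods \<open>N(w\<^sub>1)\<close>, \<open>N(w\<^sub>2)\<close>, \<open>N(w\<^sub>3)\<close>: two of the \<open>w\<^sub>i\<close> lie on the same side of \<open>w\<close>, and the
  nearer of the two is then adjacent to a common neighbor of \<open>w\<close> and the farther one.
  The right endpoints of a greedily chosen disjoint family of neighborhoods in the order of \<open>A\<close>
  stab every neighborhood, hence at least once and at most twice. Color these points alternately
  with 1 and 2 and all other vertices of \<open>A\<close> with 0. Do the same for \<open>B\<close> with three new colors.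
\<close>

text \<open>Greedy choice: the smallest right endpoint stabs every member that does not lie strictly
  to its right, and the induction treats the rest. The map \<open>g\<close> keeps a certificate for
  each point, a member of \<open>F\<close> through it. Disjointness of the certificates is what
  later bounds how many points of \<open>S\<close> a member can contain. Convexity relative to
  \<open>\<Union>F\<close> passes to subfamilies.\<close>

lemma greedy_stabbing_set:
  fixes F :: "'b::linorder set set"
  assumes "finite F"
    and "\<And>I. I \<in> F \<Longrightarrow> finite I \<and> I \<noteq> {}"
    and "\<And>I x y z. I \<in> F \<Longrightarrow> x \<in> I \<Longrightarrow> z \<in> I \<Longrightarrow> y \<in> \<Union>F \<Longrightarrow> x \<le> y \<Longrightarrow> y \<le> z \<Longrightarrow> y \<in> I"
  shows "\<exists>S g. finite S \<and> (\<forall>s\<in>S. g s \<in> F \<and> s \<in> g s) \<and>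
           (\<forall>s\<in>S. \<forall>t\<in>S. s \<noteq> t \<longrightarrow> g s \<inter> g t = {}) \<and> (\<forall>I\<in>F. S \<inter> I \<noteq> {})"
  using assms
proof (induction F rule: finite_psubset_induct)
  case (psubset F)
  show ?case
  proof (cases "F = {}")
    case True
    then show ?thesis by (intro exI[of _ "{}"]) auto
  next
    case False
    obtain J where J: "J \<in> F" "\<And>I. I \<in> F \<Longrightarrow> Max J \<le> Max I"
      using arg_min_if_finite(1)[OF psubset.hyps False, of Max]
        arg_min_least[OF psubset.hyps False, of _ Max] by blast
    let ?p = "Max J"
    define F' where "F' = {I \<in> F. \<forall>x\<in>I. ?p < x}"
    have pJ: "?p \<in> J" using J psubset.prems(1) Max_in by blast
    have "F' \<subset> F" using J(1) pJ unfolding F'_def by blast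
    moreover have "\<And>I. I \<in> F' \<Longrightarrow> finite I \<and> I \<noteq> {}"
      using psubset.prems(1) unfolding F'_def by blast
    moreover have "y \<in> I"
      if "I \<in> F'" "x \<in> I" "z \<in> I" "y \<in> \<Union>F'" "x \<le> y" "y \<le> z" for I x y z
      using psubset.prems(2)[OF _ that(2,3) _ that(5,6)] that(1,4) unfolding F'_def by blast
    ultimately have "\<exists>S g. finite S \<and> (\<forall>s\<in>S. g s \<in> F' \<and> s \<in> g s) \<and>
        (\<forall>s\<in>S. \<forall>t\<in>S. s \<noteq> t \<longrightarrow> g s \<inter> g t = {}) \<and> (\<forall>I\<in>F'. S \<inter> I \<noteq> {})"
      by (rule psubset.IH)
    then obtain S g where S: "finite S" "\<forall>s\<in>S. g s \<in> F' \<and> s \<in> g s"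
        "\<forall>s\<in>S. \<forall>t\<in>S. s \<noteq> t \<longrightarrow> g s \<inter> g t = {}" "\<forall>I\<in>F'. S \<inter> I \<noteq> {}"
      by (elim exE conjE)
    have pS: "?p \<notin> S" using S(2) unfolding F'_def by blast
    \<comment> \<open>The point \<open>?p\<close> separates the two sets: \<open>J\<close> ends
      there, and every certificate from the induction starts strictly later.\<close>
    have Jg: "J \<inter> g s = {}" if "s \<in> S" for s
    proof -
      have "x \<le> ?p" if "x \<in> J" for x using that J(1) psubset.prems(1) by simp
      moreover have "?p < x" if "x \<in> g s" for x
        using that \<open>s \<in> S\<close> S(2) unfolding F'_def by blast
      ultimately show ?thesis by force
    qed
    \<comment> \<open>Such an \<open>I\<close> has a point at or before \<open>?p\<close>, and by
      the choice of \<open>J\<close> its maximum is not before \<open>?p\<close>. Convexity then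
      puts \<open>?p\<close> into \<open>I\<close>.\<close>
    have hit: "?p \<in> I" if I: "I \<in> F" "I \<notin> F'" for I
    proof -
      obtain x where "x \<in> I" "x \<le> ?p" using I unfolding F'_def by force
      moreover have "Max I \<in> I" using I psubset.prems(1) Max_in by blast
      ultimately show ?thesis
        using psubset.prems(2)[of I x "Max I" ?p] I J pJ by blast
    qed
    let ?g = "g(?p := J)"
    have "finite (insert ?p S)" using S(1) by simp
    moreover have "\<forall>s\<in>insert ?p S. ?g s \<in> F \<and> s \<in> ?g s"
      using S(2) pS pJ J(1) unfolding F'_def by auto
    moreover have "\<forall>s\<in>insert ?p S. \<forall>t\<in>insert ?p S. s \<noteq> t \<longrightarrow> ?g s \<inter> ?g t = {}"
      using S(3) Jg pS by (auto simp: Int_commute)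
    moreover have "\<forall>I\<in>F. insert ?p S \<inter> I \<noteq> {}"
      using S(4) hit by blast
    ultimately show ?thesis by blast
  qed
qed

text \<open>Three stabbing points in one member \<open>I\<close> would give three pairwise disjoint
  certificates that all meet \<open>I\<close>, contrary to \<open>claw\<close>. So \<open>I\<close>
  contains one or two stabbing points, and alternating two colors along \<open>S\<close> separates
  them.\<close>

lemma conflict_free_coloring_of_intervals:
  fixes F :: "'b::linorder set set"
  assumes "finite F"
    and "\<And>I. I \<in> F \<Longrightarrow> finite I \<and> I \<noteq> {}"
    and conv: "\<And>I x y z. I \<in> F \<Longrightarrow> x \<in> I \<Longrightarrow> z \<in> I \<Longrightarrow> y \<in> \<Union>F \<Longrightarrow> x \<le> y \<Longrightarrow> y \<le> z \<Longrightarrow> y \<in> I"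
    and claw: "\<And>I J K L. \<lbrakk>I \<in> F; J \<in> F; K \<in> F; L \<in> F; I \<inter> J \<noteq> {}; I \<inter> K \<noteq> {}; I \<inter> L \<noteq> {};
                 J \<inter> K = {}; J \<inter> L = {}; K \<inter> L = {}\<rbrakk> \<Longrightarrow> False"
  shows "\<exists>h :: 'b \<Rightarrow> nat. range h \<subseteq> {0, 1, 2} \<and> (\<forall>I\<in>F. \<exists>a. \<exists>!u. u \<in> I \<and> h u = a)"
proof -
  have "\<exists>S g. finite S \<and> (\<forall>s\<in>S. g s \<in> F \<and> s \<in> g s) \<and>
          (\<forall>s\<in>S. \<forall>t\<in>S. s \<noteq> t \<longrightarrow> g s \<inter> g t = {}) \<and> (\<forall>I\<in>F. S \<inter> I \<noteq> {})"
    using assms(1-3) by (rule greedy_stabbing_set)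
  then obtain S g where S: "finite S" "\<forall>s\<in>S. g s \<in> F \<and> s \<in> g s"
      "\<forall>s\<in>S. \<forall>t\<in>S. s \<noteq> t \<longrightarrow> g s \<inter> g t = {}" "\<forall>I\<in>F. S \<inter> I \<noteq> {}"
    by (elim exE conjE)
  \<comment> \<open>The parity of the position within \<open>S\<close> produces the alternation;
    color 0 is reserved for points outside \<open>S\<close>.\<close>
  define rk where "rk s = card {t \<in> S. t < s}" for s
  define h where "h s = (if s \<notin> S then 0 else if even (rk s) then 1 else 2 :: nat)" for s
  have "\<exists>a. \<exists>!u. u \<in> I \<and> h u = a" if I: "I \<in> F" for I
  proof -
    obtain s where s: "s \<in> S" "s \<in> I" using S(4) I by blast
    have two: "u = x \<or> u = y"
      if xy: "x \<in> S" "x \<in> I" "y \<in> S" "y \<in> I" "x \<noteq> y" and u: "u \<in> S" "u \<in> I" for x y u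
    proof (rule ccontr)
      assume neq: "\<not> (u = x \<or> u = y)"
      show False
        by (rule claw[OF I, of "g x" "g y" "g u"]) (use S xy u neq in blast)+
    qed
    \<comment> \<open>A stabbing point strictly between \<open>x\<close> and \<open>y\<close> would
      lie in \<open>I\<close> by convexity and be a third one there. Hence \<open>y\<close> is the
      successor of \<open>x\<close> in \<open>S\<close>, and the parities differ.\<close>
    have step: "h x \<noteq> h y" if xy: "x \<in> S" "x \<in> I" "y \<in> S" "y \<in> I" "x < y" for x y
    proof -
      have "t \<le> x" if "t \<in> S" "t < y" for t
      proof (rule ccontr)
        assume "\<not> t \<le> x"
        moreover from this have "t \<in> I"
          using conv[OF I xy(2,4), of t] S(2) that by force
        ultimately show False using two[of x y t] xy that by auto
      qed
      then have "{t \<in> S. t < y} = insert x {t \<in> S. t < x}" using xy by force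
      then have "rk y = Suc (rk x)" using S(1) by (simp add: rk_def)
      then show ?thesis using xy by (simp add: h_def)
    qed
    \<comment> \<open>The color of \<open>s\<close> is nonzero, so a point sharing it must be a
      stabbing point.\<close>
    have "u = s" if "u \<in> I" "h u = h s" for u
    proof -
      have "u \<in> S" using that(2) s(1) by (auto simp: h_def split: if_splits)
      then show ?thesis using step[of u s] step[of s u] s that by (metis neqE)
    qed
    then show ?thesis using s by blast
  qed
  moreover have "range h \<subseteq> {0, 1, 2}" by (auto simp: h_def)
  ultimately show ?thesis by blast
qed

text \<open>Transfers an order given as a relation to the naturals, where the interval lemmas apply.
  The rank is the size of the down-set: if \<open>(x, y)\<close> is not in \<open>r\<close>, the
  down-set of \<open>y\<close> is properly contained in that of \<open>x\<close>, since
  \<open>x\<close> itself is missing from it.\<close>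

lemma linear_order_on_rank:
  assumes "finite A" "linear_order_on A r"
  shows "\<exists>f :: 'a \<Rightarrow> nat. inj_on f A \<and> (\<forall>x\<in>A. \<forall>y\<in>A. f x \<le> f y \<longrightarrow> (x, y) \<in> r)"
proof -
  have tot: "(x, y) \<in> r \<or> (y, x) \<in> r" if "x \<in> A" "y \<in> A" for x y
    using that assms(2) unfolding order_on_defs total_on_def refl_on_def by metis
  have tr: "trans r" and anti: "antisym r"
    using assms(2) unfolding order_on_defs by auto
  define f where "f x = card {z \<in> A. (z, x) \<in> r}" for x
  have le: "(x, y) \<in> r" if "x \<in> A" "y \<in> A" "f x \<le> f y" for x y
  proof (rule ccontr)
    assume no: "(x, y) \<notin> r"
    then have yx: "(y, x) \<in> r" using tot that by blast
    have "{z \<in> A. (z, y) \<in> r} \<subset> {z \<in> A. (z, x) \<in> r}"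
      using no yx tr tot[of x x] that(1) by (auto dest: transD)
    then have "f y < f x" unfolding f_def using assms(1) by (simp add: psubset_card_mono)
    with that show False by simp
  qed
  moreover have "inj_on f A"
    using le anti by (intro inj_onI) (metis antisymD order_refl)
  ultimately show ?thesis by blast
qed

text \<open>One side of the construction, to be applied twice with the parts exchanged. The order
  \<open>r\<close> of \<open>A\<close> turns neighborhoods into intervals, while the order
  \<open>q\<close> of \<open>B\<close> excludes claws among them.\<close>

lemma biconvex_conflict_free_part:
  assumes G: "pair_graph G" and bip: "bipartition G A B"
    and rA: "linear_order_on A r" "\<forall>w\<in>B. consecutive_in r (neighborhood G w)"
    and rB: "linear_order_on B q" "\<forall>w\<in>A. consecutive_in q (neighborhood G w)"
  shows "\<exists>h :: 'a \<Rightarrow> nat. range h \<subseteq> {0, 1, 2} \<and>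
           (\<forall>w\<in>B. neighborhood G w \<noteq> {} \<longrightarrow> (\<exists>a. \<exists>!u. u \<in> neighborhood G w \<and> h u = a))"
proof -
  interpret pair_graph G by fact
  let ?N = "neighborhood G"
  have fin: "finite A" "finite B"
    using bip pair_finite_verts unfolding bipartition_def by (metis finite_Un)+
  have NA: "?N w \<subseteq> A" if "w \<in> B" for w
    using bip that unfolding bipartition_def neighborhood_def by blast
  have sym: "x \<in> ?N y \<longleftrightarrow> y \<in> ?N x" for x y
    using arcs_symmetric unfolding neighborhood_def by auto
  obtain f :: "'a \<Rightarrow> nat" where f: "inj_on f A" "\<And>x y. x \<in> A \<Longrightarrow> y \<in> A \<Longrightarrow> f x \<le> f y \<Longrightarrow> (x, y) \<in> r"
    using linear_order_on_rank[OF fin(1) rA(1)] by blast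
  have tot: "(x, y) \<in> q \<or> (y, x) \<in> q" if "x \<in> B" "y \<in> B" for x y
    using that rB(1) unfolding order_on_defs total_on_def refl_on_def by metis
  \<comment> \<open>A common neighbor \<open>a\<close> of \<open>w\<close> and \<open>w'\<close> has
    both in its neighborhood, which is consecutive in \<open>q\<close> and therefore contains
    \<open>v\<close> as well.\<close>
  have between: "?N v \<inter> ?N w' \<noteq> {}"
    if H: "w \<in> B" "w' \<in> B" "?N w \<inter> ?N w' \<noteq> {}"
      "(w, v) \<in> q \<and> (v, w') \<in> q \<or> (w', v) \<in> q \<and> (v, w) \<in> q" for v w w'
  proof -
    obtain a where a: "a \<in> ?N w" "a \<in> ?N w'" using H(3) by blast
    then have "a \<in> A" using NA H(1) by blast
    then have "v \<in> ?N a"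
      using rB(2) a sym H(4) unfolding consecutive_in_def by blast
    then show ?thesis using a sym by blast
  qed
  have claw: False
    if "w \<in> B" "w1 \<in> B" "w2 \<in> B" "w3 \<in> B"
      "?N w \<inter> ?N w1 \<noteq> {}" "?N w \<inter> ?N w2 \<noteq> {}" "?N w \<inter> ?N w3 \<noteq> {}"
      "?N w1 \<inter> ?N w2 = {}" "?N w1 \<inter> ?N w3 = {}" "?N w2 \<inter> ?N w3 = {}" for w w1 w2 w3
  proof -
    have sep: "\<not> ((w, v) \<in> q \<and> (v, v') \<in> q) \<and> \<not> ((v', v) \<in> q \<and> (v, w) \<in> q)"
      if "v' \<in> B" "?N w \<inter> ?N v' \<noteq> {}" "?N v \<inter> ?N v' = {}" for v v'
      using between[OF \<open>w \<in> B\<close> that(1,2)] that(3) by blast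
    have disj: "?N w2 \<inter> ?N w1 = {}" "?N w3 \<inter> ?N w1 = {}" "?N w3 \<inter> ?N w2 = {}"
      using that(8-10) by (simp_all add: Int_commute)
    \<comment> \<open>What remains is propositional: two of \<open>w1\<close>, \<open>w2\<close>,
      \<open>w3\<close> lie on the same side of \<open>w\<close>, and \<open>sep\<close>, taken for
      all six ordered pairs, forbids either of these two to be the nearer one.\<close>
    note sep[OF that(3,6,8)] sep[OF that(4,7,9)] sep[OF that(2,5) disj(1)]
      sep[OF that(4,7,10)] sep[OF that(2,5) disj(2)] sep[OF that(3,6) disj(3)]
    moreover note tot[OF that(1,2)] tot[OF that(1,3)] tot[OF that(1,4)]
      tot[OF that(2,3)] tot[OF that(2,4)] tot[OF that(3,4)]
    ultimately show False by argo
  qed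
  \<comment> \<open>Isolated vertices are left out because the interval lemma requires nonempty
    members.\<close>
  define F where "F = (\<lambda>w. f ` ?N w) ` {w \<in> B. ?N w \<noteq> {}}"
  have Int: "f ` ?N v \<inter> f ` ?N w = {} \<longleftrightarrow> ?N v \<inter> ?N w = {}" if "v \<in> B" "w \<in> B" for v w
    using inj_on_image_Int[OF f(1) NA NA] that by (metis image_is_empty)
  have "\<exists>h :: nat \<Rightarrow> nat. range h \<subseteq> {0, 1, 2} \<and> (\<forall>I\<in>F. \<exists>a. \<exists>!u. u \<in> I \<and> h u = a)"
  proof (rule conflict_free_coloring_of_intervals)
    show "finite F" using fin F_def by simp
    show "finite I \<and> I \<noteq> {}" if "I \<in> F" for I
      using that fin NA finite_subset unfolding F_def by blast
    show "y \<in> I"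
      if H: "I \<in> F" "x \<in> I" "z \<in> I" "y \<in> \<Union>F" "x \<le> y" "y \<le> z" for I x y z
    proof -
      obtain w where w: "w \<in> B" "I = f ` ?N w" using H(1) F_def by blast
      obtain x' z' where xz: "x' \<in> ?N w" "x = f x'" "z' \<in> ?N w" "z = f z'"
        using H(2,3) w by blast
      obtain y' where y: "y' \<in> A" "y = f y'" using H(4) NA unfolding F_def by blast
      have "(x', y') \<in> r" "(y', z') \<in> r" using f(2) H xz y NA w by blast+
      then have "y' \<in> ?N w" using rA(2) w xz unfolding consecutive_in_def by blast
      then show ?thesis using w y by blast
    qed
    show False
      if H: "I \<in> F" "J \<in> F" "K \<in> F" "L \<in> F" "I \<inter> J \<noteq> {}" "I \<inter> K \<noteq> {}" "I \<inter> L \<noteq> {}"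
        "J \<inter> K = {}" "J \<inter> L = {}" "K \<inter> L = {}" for I J K L
    proof -
      obtain w w1 w2 w3 where w: "w \<in> B" "w1 \<in> B" "w2 \<in> B" "w3 \<in> B"
          "I = f ` ?N w" "J = f ` ?N w1" "K = f ` ?N w2" "L = f ` ?N w3"
        using H(1-4) unfolding F_def by blast
      show False
        using claw[OF w(1-4)] H(5-10) unfolding w(5-8) by (simp add: Int w(1-4))
    qed
  qed
  then obtain h :: "nat \<Rightarrow> nat" where h: "range h \<subseteq> {0, 1, 2}"
      "\<forall>I\<in>F. \<exists>a. \<exists>!u. u \<in> I \<and> h u = a"
    by (elim exE conjE)
  have "\<exists>a. \<exists>!u. u \<in> ?N w \<and> (h \<circ> f) u = a" if w: "w \<in> B" "?N w \<noteq> {}" for w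
  proof -
    have "f ` ?N w \<in> F" using w F_def by blast
    then obtain a u where u: "u \<in> ?N w" "h (f u) = a"
        "\<And>v. v \<in> ?N w \<Longrightarrow> h (f v) = a \<Longrightarrow> f v = f u"
      using bspec[OF h(2)] by blast
    \<comment> \<open>Uniqueness among ranks becomes uniqueness among vertices because
      \<open>f\<close> is injective on \<open>A\<close>.\<close>
    have "v = u" if "v \<in> ?N w" "h (f v) = a" for v
      using inj_onD[OF f(1) u(3)[OF that]] that(1) u(1) NA[OF w(1)] by blast
    then show ?thesis unfolding comp_def using u(1,2) by blast
  qed
  moreover have "range (h \<circ> f) \<subseteq> {0, 1, 2}" using h(1) unfolding image_subset_iff comp_def by blast
  ultimately show ?thesis by blast
qed

theorem lemma1p6:
  fixes G :: "'a pair_pre_digraph" and A B :: "'a set"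
  assumes "pair_graph G" and "biconvex G A B"
  shows "\<exists>c :: 'a \<Rightarrow> nat.
           proper_conflict_free_coloring G 6 c \<and> card (c ` A) \<le> 3 \<and> card (c ` B) \<le> 3"
proof -
  let ?N = "neighborhood G"
  obtain r q where bip: "bipartition G A B"
    and r: "linear_order_on A r" "\<forall>w\<in>B. consecutive_in r (?N w)"
    and q: "linear_order_on B q" "\<forall>w\<in>A. consecutive_in q (?N w)"
    using assms(2) unfolding biconvex_def by blast
  have bip': "bipartition G B A" using bip unfolding bipartition_def by blast
  obtain h :: "'a \<Rightarrow> nat" where h: "range h \<subseteq> {0, 1, 2}"
      "\<And>w. w \<in> B \<Longrightarrow> ?N w \<noteq> {} \<Longrightarrow> \<exists>a. \<exists>!u. u \<in> ?N w \<and> h u = a"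
    using biconvex_conflict_free_part[OF assms(1) bip r q] by (elim exE conjE) simp
  obtain k :: "'a \<Rightarrow> nat" where k: "range k \<subseteq> {0, 1, 2}"
      "\<And>w. w \<in> A \<Longrightarrow> ?N w \<noteq> {} \<Longrightarrow> \<exists>a. \<exists>!u. u \<in> ?N w \<and> k u = a"
    using biconvex_conflict_free_part[OF assms(1) bip' q r] by (elim exE conjE) simp
  \<comment> \<open>The shift by 3 makes the palettes of \<open>A\<close> and \<open>B\<close>
    disjoint, which gives properness. Being injective, it also preserves the unique colors that
    \<open>k\<close> provides.\<close>
  define c where "c v = (if v \<in> A then h v else k v + 3)" for v
  have V: "pverts G = A \<union> B" and disj: "A \<inter> B = {}"
    and E: "parcs G \<subseteq> A \<times> B \<union> B \<times> A"
    using bip unfolding bipartition_def by auto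
  have hk: "h v \<in> {0, 1, 2}" "k v \<in> {0, 1, 2}" for v using h(1) k(1) by blast+
  have "c v \<in> {0, 1, 2}" if "v \<in> A" for v
    using hk(1)[of v] that by (simp add: c_def)
  moreover have "c v \<in> {3, 4, 5}" if "v \<in> B" for v
  proof -
    have "v \<notin> A" using that disj by blast
    then show ?thesis using hk(2)[of v] by (auto simp: c_def)
  qed
  ultimately have cA: "c ` A \<subseteq> {0, 1, 2}" and cB: "c ` B \<subseteq> {3, 4, 5}"
    by (simp_all only: image_subset_iff, blast+)
  have card: "card (c ` A) \<le> 3" "card (c ` B) \<le> 3"
    using card_mono[OF _ cA] card_mono[OF _ cB] by simp_all
  then have "card (c ` pverts G) \<le> 6"
    unfolding V image_Un using card_Un_le[of "c ` A" "c ` B"] by linarith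
  moreover have "c u \<noteq> c v" if "(u, v) \<in> parcs G" for u v
  proof -
    have "c ` A \<inter> c ` B = {}" using cA cB by fastforce
    then show ?thesis using that E by blast
  qed
  \<comment> \<open>All neighbors of \<open>v\<close> lie in the opposite part, so \<open>c\<close>
    agrees on them with \<open>h\<close> or with the shifted \<open>k\<close>.\<close>
  moreover have "\<exists>a. \<exists>!u. u \<in> ?N v \<and> c u = a" if "v \<in> pverts G" "?N v \<noteq> {}" for v
  proof (cases "v \<in> B")
    case True
    then have "c u = h u" if "u \<in> ?N v" for u
      using that E disj unfolding neighborhood_def c_def by auto
    then show ?thesis using h(2)[OF True that(2)] by metis
  next
    case False
    then have "v \<in> A" using that V by blast
    then have "c u = k u + 3" if "u \<in> ?N v" for u
      using that E disj unfolding neighborhood_def c_def by auto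
    then show ?thesis using k(2)[OF \<open>v \<in> A\<close> that(2)] by (metis add_right_cancel)
  qed
  ultimately show ?thesis
    using card unfolding proper_conflict_free_coloring_def proper_coloring_def by blast
qed

end
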